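(* Let $\alpha, \gamma > -1$ and let $m,n\ge 0$ be integers. Then $$P^{(\alpha)}_{m,n} = \frac{\Gamma(m+1) \Gamma(n+1) \Gamma(\alpha+1)}{\Gamma(\alpha + m + 1) \Gamma(\alpha + n + 1) \Gamma(\gamma+1)} \sum_{k=0}^{\min(m,n)} c_k \, P^{(\gamma)}_{m-k,n-k},$$ where $$c_k = \frac{(\alpha-\gamma)_{k}\, \Gamma(\alpha+m+n-k+1)}{\Gamma(k+1)} \cdot \frac{\Gamma(\gamma+m-k+1)\, \Gamma(\gamma+n-k+1)\, (\gamma+m+n-2k+1)}{\Gamma(m-k+1)\, \Gamma(n-k+1)\, \Gamma(\gamma + m + n - k + 2)}.$$
   Context: $B^2$ is the open unit disk of $\mathbb{R}^2$ with polar coordinates $(r,\theta)$. For $\alpha>-1$ and integers $m,n\ge0$ the Zernike polynomial $P^{(\alpha)}_{m,n}\colon B^2\to\mathbb{C}$ is $$P^{(\alpha)}_{m,n} = \frac{\Gamma(\min(m,n)+1)\, \Gamma(\alpha+1)}{\Gamma(\min(m,n) + \alpha + 1)}\, r^{|m-n|} e^{\mathrm{i} (m-n) \theta}\, P^{(\alpha,|m-n|)}_{\min(m,n)}(2r^2-1),$$ where $P^{(a,b)}_k$ is the Jacobi polynomial of degree $k$, orthogonal on $(-1,1)$ with respect to $(1-t)^a(1+t)^b$ and normalized by $P^{(a,b)}_k(1)=\binom{k+a}{k}$. The Pochhammer symbol is $(a)_n=\prod_{k=0}^{n-1}(a+k)$, $(a)_0=1$. *)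

theory Defs
  imports "HOL-Analysis.Analysis" "HOL-Computational_Algebra.Computational_Algebra"
begin

section \<open>Jacobi polynomials\<close>

text \<open>
  The real exponents are only ever evaluated at positive bases, since the integral ranges over the
  open interval. Stating orthogonality with \<^const>\<open>has_integral\<close> includes the existence of the
  integral.
\<close>

definition is_jacobi_poly :: "real \<Rightarrow> real \<Rightarrow> nat \<Rightarrow> real poly \<Rightarrow> bool" where
  "is_jacobi_poly a b k p \<longleftrightarrow>
     degree p = k \<and>
     (\<forall>q. degree q < k \<longrightarrow>
        ((\<lambda>t. (1 - t) powr a * (1 + t) powr b * (poly p t * poly q t))
           has_integral 0) {-1<..<1}) \<and>
     poly p 1 = (real k + a) gchoose k"

definition jacobi_poly :: "real \<Rightarrow> real \<Rightarrow> nat \<Rightarrow> real poly" where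
  "jacobi_poly a b k = (THE p. is_jacobi_poly a b k p)"

lemma is_jacobi_poly_unique:
  assumes "a > -1" and p1: "is_jacobi_poly a b k p1" and p2: "is_jacobi_poly a b k p2"
  shows "p1 = p2"
proof (cases "k = 0")
  case True
  then obtain c d where "p1 = [:c:]" "p2 = [:d:]"
    using p1 p2 unfolding is_jacobi_poly_def by (meson degree_eq_zeroE)
  then show ?thesis using p1 p2 True by (simp add: is_jacobi_poly_def)
next
  case False
  have deg: "degree p1 = k" "degree p2 = k"
    and val: "poly p1 1 = poly p2 1" "poly p2 1 = (real k + a) gchoose k"
    using p1 p2 by (auto simp: is_jacobi_poly_def)
  have "(real k + a) gchoose k = pochhammer (a + 1) k / fact k"
    by (simp add: gbinomial_pochhammer')
  moreover have "pochhammer (a + 1) k > 0"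
    using assms(1) by (intro pochhammer_pos) simp
  ultimately have val0: "poly p2 1 \<noteq> 0" using val by simp
  have lc: "lead_coeff p2 \<noteq> 0" using deg False by (metis degree_0 leading_coeff_0_iff)
  define c where "c = lead_coeff p1 / lead_coeff p2"
  define d where "d = p1 - smult c p2"
  have "coeff d k = 0" using lc deg by (simp add: d_def c_def)
  moreover have "degree d \<le> k"
    unfolding d_def using deg by (intro degree_diff_le) auto
  ultimately have dk: "degree d < k"
    using False by (metis degree_0 leading_coeff_0_iff le_neq_implies_less not_gr_zero)
  define w where "w = (\<lambda>t::real. (1 - t) powr a * (1 + t) powr b)"
  have i1: "((\<lambda>t. w t * (poly p1 t * poly d t)) has_integral 0) {-1<..<1}"
    and i2: "((\<lambda>t. w t * (poly p2 t * poly d t)) has_integral 0) {-1<..<1}"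
    using p1 p2 dk unfolding is_jacobi_poly_def w_def by auto
  have id: "((\<lambda>t. w t * (poly d t)^2) has_integral 0) {-1<..<1}"
    using has_integral_diff[OF i1 has_integral_mult_right[OF i2, of c]]
    by (simp add: d_def algebra_simps power2_eq_square)
  have w_pos: "w t > 0" if "t \<in> {-1<..<1}" for t
    using that by (auto simp: w_def)
  have zero: "poly d x = 0" if x: "x \<in> {-1/2..1/2}" for x
  proof -
    have cont: "continuous_on (cbox (-1/2) (1/2)) (\<lambda>t. w t * (poly d t)^2)"
      unfolding w_def by (intro continuous_intros) auto
    then obtain i where i: "((\<lambda>t. w t * (poly d t)^2) has_integral i) (cbox (-1/2) (1/2))"
      using integrable_continuous integrable_on_def by blast
    have nonneg: "0 \<le> w t * (poly d t)^2" if "t \<in> {-1<..<1}" for t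
      using w_pos[OF that] by simp
    have "i \<le> 0"
      by (rule has_integral_subset_le[OF _ i id]) (use nonneg in auto)
    moreover have "0 \<le> i"
      by (rule has_integral_nonneg[OF i]) (use nonneg in auto)
    ultimately have i0: "((\<lambda>t. w t * (poly d t)^2) has_integral 0) (cbox (-1/2) (1/2))"
      using i by simp
    have "w x * (poly d x)^2 = 0"
      by (rule has_integral_0_cbox_imp_0[OF cont _ i0]) (use nonneg x in auto)
    then show ?thesis using w_pos[of x] x by auto
  qed
  have "infinite {-1/2..1/2::real}" by simp
  then have "d = 0"
    using zero poly_roots_finite[of d] by (metis (mono_tags, lifting) finite_subset mem_Collect_eq subsetI)
  then have eq: "p1 = smult c p2" by (simp add: d_def)
  then have "c = 1" using val val0 by simp
  then show ?thesis using eq by simp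
qed

lemma has_integral_jacobi_moment:
  fixes a b :: real
  assumes "a > -1" "b > -1"
  shows "((\<lambda>t. (1 - t) powr a * (1 + t) powr b * (((1 - t) / 2) ^ j * ((1 + t) / 2) ^ i))
           has_integral 2 powr (a + b + 1) * Beta (b + 1 + real i) (a + 1 + real j)) {-1<..<1}"
proof -
  have "((\<lambda>s. s powr (b + 1 + real i - 1) * (1 - s) powr (a + 1 + real j - 1)) has_integral
          Beta (b + 1 + real i) (a + 1 + real j)) (cbox 0 1)"
    unfolding cbox_interval using assms by (intro has_integral_Beta_real) auto
  from has_integral_affinity'[OF this, of "1/2" "1/2"]
  have "((\<lambda>t. ((1 + t) / 2) powr (b + real i) * ((1 - t) / 2) powr (a + real j)) has_integral
          2 * Beta (b + 1 + real i) (a + 1 + real j)) {-1<..<1}"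
    by (simp add: has_integral_Icc_iff_Ioo field_simps)
  from has_integral_mult_right[OF this, of "2 powr (a + b)"]
  have "((\<lambda>t. 2 powr (a + b) * (((1 + t) / 2) powr (b + real i) * ((1 - t) / 2) powr (a + real j)))
          has_integral 2 powr (a + b + 1) * Beta (b + 1 + real i) (a + 1 + real j)) {-1<..<1}"
    by (simp add: powr_add mult_ac)
  then show ?thesis
  proof (rule has_integral_eq[rotated])
    fix t :: real assume t: "t \<in> {-1<..<1}"
    have "((1 + t) / 2) powr (b + real i) = ((1 + t) powr b / 2 powr b) * ((1 + t) / 2) ^ i"
      "((1 - t) / 2) powr (a + real j) = ((1 - t) powr a / 2 powr a) * ((1 - t) / 2) ^ j"
      using t by (auto simp: powr_add powr_divide powr_realpow power_divide)
    then show "2 powr (a + b) * (((1 + t) / 2) powr (b + real i) * ((1 - t) / 2) powr (a + real j)) =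
      (1 - t) powr a * (1 + t) powr b * (((1 - t) / 2) ^ j * ((1 + t) / 2) ^ i)"
      by (simp add: powr_add)
  qed
qed

lemma is_jacobi_poly_exists:
  assumes a: "a > -1" and b: "b > -1"
  shows "\<exists>p. is_jacobi_poly a b k p"
proof -
  define h where "h j = pochhammer (real k + a + b + 1) j * pochhammer (- real k) j /
      (fact j * pochhammer (a + 1) j)" for j
  define C where "C = pochhammer (a + 1) k / fact k"
  define p where "p = smult C (\<Sum>j\<le>k. smult (h j) ([:1/2, -1/2:] ^ j))"
  have pa: "pochhammer (a + 1) j > 0" for j using a by (intro pochhammer_pos) simp
  have poly_p: "poly p t = C * (\<Sum>j\<le>k. h j * ((1 - t) / 2) ^ j)" for t
    by (simp add: p_def poly_sum diff_divide_distrib)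
  have deg_le: "degree p \<le> k"
    unfolding p_def
    by (intro order.trans[OF degree_smult_le] degree_sum_le)
       (auto intro!: order.trans[OF degree_smult_le] order.trans[OF degree_power_le])
  have "coeff p k = C * (\<Sum>j\<le>k. h j * coeff ([:1/2, -1/2:] ^ j) k)"
    by (simp add: p_def coeff_sum)
  also have "(\<Sum>j\<le>k. h j * coeff ([:1/2, -1/2:] ^ j) k) =
             (\<Sum>j\<in>{k}. h j * coeff ([:1/2, -1/2:] ^ j) k)"
    by (intro sum.mono_neutral_right) (auto intro!: coeff_eq_0 simp: degree_power_eq)
  also have "\<dots> = h k * (-1/2) ^ k"
    using lead_coeff_power[of "[:1/2, -1/2::real:]" k] by (simp add: degree_power_eq)
  finally have cf: "coeff p k = C * (h k * (-1/2) ^ k)" .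
  have "pochhammer (real k + a + b + 1) k \<noteq> 0"
    using a b by (cases "k = 0") (auto intro!: pochhammer_pos less_imp_neq[symmetric])
  moreover have "pochhammer (- real k) k \<noteq> 0"
    by (simp add: pochhammer_of_nat_eq_0_iff)
  ultimately have "coeff p k \<noteq> 0"
    using pa[of k] by (auto simp: cf h_def C_def)
  then have deg: "degree p = k" using deg_le by (simp add: le_antisym le_degree)
  have val: "poly p 1 = (real k + a) gchoose k"
  proof -
    have "poly p 1 = C * (\<Sum>j\<in>{0}. h j * 0 ^ j)"
      unfolding poly_p by (subst sum.mono_neutral_left[of "{..k}" "{0}"]) auto
    also have "\<dots> = C" by (simp add: h_def)
    finally show ?thesis by (simp add: C_def gbinomial_pochhammer')
  qed
  have orth1: "((\<lambda>t. (1 - t) powr a * (1 + t) powr b * (poly p t * ((1 + t) / 2) ^ i))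
                  has_integral 0) {-1<..<1}" if i: "i < k" for i
  proof -
    define c where "c = a + b + 2 + real i"
    have c: "c > 0" using a b by (simp add: c_def)
    have B: "Beta (b + 1 + real i) (a + 1 + real j) =
        Gamma (b + 1 + real i) * Gamma (a + 1) / Gamma c * (pochhammer (a + 1) j / pochhammer c j)" for j
    proof -
      have "a + 1 \<notin> \<int>\<^sub>\<le>\<^sub>0" "c \<notin> \<int>\<^sub>\<le>\<^sub>0"
        using a c by (auto elim!: nonpos_Ints_cases)
      then have "pochhammer (a + 1) j = Gamma (a + 1 + real j) / Gamma (a + 1)"
        "pochhammer c j = Gamma (c + real j) / Gamma c"
        by (simp_all add: pochhammer_Gamma)
      moreover have "Gamma (a + 1) > 0" "Gamma c > 0" using a c by (auto intro: Gamma_real_pos)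
      ultimately show ?thesis
        by (simp add: Beta_def c_def algebra_simps)
    qed
    have hB: "h j * Beta (b + 1 + real i) (a + 1 + real j) =
        Gamma (b + 1 + real i) * Gamma (a + 1) / Gamma c *
        (pochhammer (real k + a + b + 1) j * pochhammer (- real k) j / (of_nat (fact j) * pochhammer c j))" for j
      unfolding B h_def using pa[of j] by (simp add: field_simps)
    have "(\<Sum>j = 0..k. pochhammer (real k + a + b + 1) j * pochhammer (- real k) j /
             (of_nat (fact j) * pochhammer c j)) = pochhammer (c - (real k + a + b + 1)) k / pochhammer c k"
      by (rule Vandermonde_pochhammer) (use c in auto)
    also have "c - (real k + a + b + 1) = - real (k - 1 - i)"
      using i by (simp add: c_def of_nat_diff)
    also have "pochhammer (- real (k - 1 - i)) k = 0"
      using i by (subst pochhammer_of_nat_eq_0_iff) auto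
    finally have van: "(\<Sum>j\<le>k. pochhammer (real k + a + b + 1) j * pochhammer (- real k) j /
             (of_nat (fact j) * pochhammer c j)) = 0"
      by (simp add: atMost_atLeast0)
    have sum0: "(\<Sum>j\<le>k. h j * Beta (b + 1 + real i) (a + 1 + real j)) = 0"
      unfolding hB sum_distrib_left[symmetric] van by simp
    have "((\<lambda>t. \<Sum>j\<le>k. C * h j * ((1 - t) powr a * (1 + t) powr b * (((1 - t) / 2) ^ j * ((1 + t) / 2) ^ i)))
       has_integral (\<Sum>j\<le>k. C * h j * (2 powr (a + b + 1) * Beta (b + 1 + real i) (a + 1 + real j))))
       {-1<..<1}"
      by (intro has_integral_sum has_integral_mult_right has_integral_jacobi_moment a b) auto
    moreover have "(\<Sum>j\<le>k. C * h j * (2 powr (a + b + 1) * Beta (b + 1 + real i) (a + 1 + real j))) =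
        C * 2 powr (a + b + 1) * (\<Sum>j\<le>k. h j * Beta (b + 1 + real i) (a + 1 + real j))"
      unfolding sum_distrib_left by (intro sum.cong) auto
    moreover have "(\<lambda>t. \<Sum>j\<le>k. C * h j * ((1 - t) powr a * (1 + t) powr b * (((1 - t) / 2) ^ j * ((1 + t) / 2) ^ i)))
       = (\<lambda>t. (1 - t) powr a * (1 + t) powr b * (poly p t * ((1 + t) / 2) ^ i))"
      unfolding poly_p sum_distrib_left sum_distrib_right
      by (intro ext sum.cong) (auto simp: mult_ac)
    ultimately show ?thesis using sum0 by simp
  qed
  have orth: "((\<lambda>t. (1 - t) powr a * (1 + t) powr b * (poly p t * poly q t)) has_integral 0) {-1<..<1}"
    if q: "degree q < k" for q
  proof -
    define r where "r = pcompose q [:-1, 2:]"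
    have dr: "degree r = degree q" by (simp add: r_def degree_pcompose)
    have pq: "poly q t = (\<Sum>i\<le>degree q. coeff r i * ((1 + t) / 2) ^ i)" for t
    proof -
      have "poly r ((1 + t) / 2) = poly q t"
        by (simp add: r_def poly_pcompose add_divide_distrib)
      then show ?thesis using dr by (simp add: poly_altdef)
    qed
    have "((\<lambda>t. \<Sum>i\<le>degree q. coeff r i * ((1 - t) powr a * (1 + t) powr b * (poly p t * ((1 + t) / 2) ^ i)))
       has_integral (\<Sum>i\<le>degree q. coeff r i * 0)) {-1<..<1}"
      by (intro has_integral_sum has_integral_mult_right orth1) (use q in auto)
    moreover have "(\<lambda>t. \<Sum>i\<le>degree q. coeff r i * ((1 - t) powr a * (1 + t) powr b * (poly p t * ((1 + t) / 2) ^ i)))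
       = (\<lambda>t. (1 - t) powr a * (1 + t) powr b * (poly p t * poly q t))"
      unfolding pq sum_distrib_left
      by (intro ext sum.cong) (auto simp: mult_ac)
    ultimately show ?thesis by simp
  qed
  show ?thesis
    using deg val orth unfolding is_jacobi_poly_def by blast
qed

lemma is_jacobi_poly_jacobi_poly:
  assumes "a > -1" "b > -1"
  shows "is_jacobi_poly a b k (jacobi_poly a b k)"
  unfolding jacobi_poly_def
  by (rule theI') (use assms is_jacobi_poly_exists is_jacobi_poly_unique in blast)


section \<open>Zernike polynomials\<close>

text \<open>
  The plane is identified with the complex numbers, so that the open unit disk is
  \<^term>\<open>ball 0 1 :: complex set\<close> and \<^term>\<open>cmod z\<close>, \<^term>\<open>Arg z\<close> are the polar coordinates of
  \<^term>\<open>z\<close>. Lemma \<open>zernike_rcis\<close> shows that the choice of the angle is immaterial, also at the origin.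
\<close>

definition zernike :: "real \<Rightarrow> nat \<Rightarrow> nat \<Rightarrow> complex \<Rightarrow> complex" where
  "zernike \<alpha> m n z =
     (let r = cmod z; \<theta> = Arg z; l = min m n; d = nat \<bar>int m - int n\<bar> in
      of_real (Gamma (real l + 1) * Gamma (\<alpha> + 1) / Gamma (real l + \<alpha> + 1)) *
      of_real (r ^ d) * exp (\<i> * of_int (int m - int n) * of_real \<theta>) *
      of_real (poly (jacobi_poly \<alpha> (real d) l) (2 * r\<^sup>2 - 1)))"

lemma zernike_rcis:
  assumes "r \<ge> 0"
  shows "zernike \<alpha> m n (rcis r \<theta>) =
     of_real (Gamma (real (min m n) + 1) * Gamma (\<alpha> + 1) / Gamma (real (min m n) + \<alpha> + 1)) *
     of_real (r ^ nat \<bar>int m - int n\<bar>) * exp (\<i> * of_int (int m - int n) * of_real \<theta>) *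
     of_real (poly (jacobi_poly \<alpha> \<bar>real m - real n\<bar> (min m n)) (2 * r\<^sup>2 - 1))"
proof -
  have real_d: "real (nat \<bar>int m - int n\<bar>) = \<bar>real m - real n\<bar>" by linarith
  have norm: "cmod (rcis r \<theta>) = r" using assms by simp
  have "of_real (r ^ nat \<bar>int m - int n\<bar>) * exp (\<i> * of_int (int m - int n) * of_real (Arg (rcis r \<theta>)))
      = of_real (r ^ nat \<bar>int m - int n\<bar>) * exp (\<i> * of_int (int m - int n) * of_real \<theta>)"
  proof (cases "r = 0 \<or> m = n")
    case True
    then show ?thesis by auto
  next
    case False
    then have "r > 0" using assms by simp
    then have "cis (Arg (rcis r \<theta>)) = cis \<theta>"
      by (subst cis_Arg) (auto simp: sgn_div_norm rcis_def norm_mult scaleR_conv_of_real)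
    moreover have "exp (\<i> * of_int (int m - int n) * of_real x) = cis x powi (int m - int n)" for x
      by (simp only: cis_conv_exp exp_power_int mult_ac)
    ultimately show ?thesis by (simp only:)
  qed
  then show ?thesis
    unfolding zernike_def Let_def norm real_d by (simp only: mult.assoc)
qed

end

theory Submission
  imports Defs
begin

text \<open>
  In powers of \<open>s = r\<^sup>2\<close>, the coefficients of \<open>P\<^sup>(\<^sup>\<alpha>\<^sup>)\<close> follow from the expansion of the Jacobi
  polynomial at \<open>-1\<close>, which is identified by its orthogonality to the powers of \<open>1 - t\<close> and by its
  value at \<open>1\<close>, both instances of the Chu-Vandermonde sum. Comparing coefficients of \<open>s ^ (l - i)\<close>,
  \<open>l = min m n\<close>, reduces the connection formula to the terminating very-well-poised sum
  \<open>4F3(a, 1 + a/2, y, -i; a/2, 1 + a - y, 1 + a + i; -1) = (1 + a)\<^sub>i / (1 + a - y)\<^sub>i\<close> with \<open>a = - h\<close>,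
  \<open>h = \<gamma> + m + n + 1\<close>, \<open>y = \<alpha> - \<gamma>\<close>, which is proved by the Wilf-Zeilberger method.
\<close>

section \<open>A terminating very-well-poised hypergeometric sum\<close>

text \<open>The right-hand side is the telescoping function found by solving for a WZ certificate.\<close>

lemma wz_partial_sum:
  fixes h y :: real
  assumes h: "h > 2 * real i + 1" and "K \<le> i"
  defines "T \<equiv> \<lambda>i k. (-1) ^ k * real (i choose k) * pochhammer y k *
      pochhammer (h - real i + y) (i - k) * (h - 2 * real k) / pochhammer (h - real i - real k) (Suc i)"
  shows "(\<Sum>k\<le>K. T (Suc i) k - T i k) =
    (-1) ^ K * real (i choose K) * pochhammer y (Suc K) *
      pochhammer (h - real i + y) (i - K) / pochhammer (h - real i - real K - 1) (Suc i)"
  using \<open>K \<le> i\<close>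
proof (induction K)
  case 0
  have "pochhammer (h - real (Suc i) + y) (Suc i) = (h - real i - 1 + y) * pochhammer (h - real i + y) i"
    by (simp add: pochhammer_rec algebra_simps)
  moreover have "pochhammer (h - real (Suc i)) (Suc (Suc i)) = (h - real i - 1) * (pochhammer (h - real i) i * h)"
    by (subst pochhammer_rec) (simp add: pochhammer_Suc algebra_simps)
  moreover have "pochhammer (h - real i) (Suc i) = pochhammer (h - real i) i * h"
    by (simp add: pochhammer_Suc)
  moreover have "pochhammer (h - real i - 1) (Suc i) = (h - real i - 1) * pochhammer (h - real i) i"
    by (simp add: pochhammer_rec algebra_simps)
  moreover have "h > 0" "h - real i - 1 > 0" "pochhammer (h - real i) i > 0"
    using h by (auto intro!: pochhammer_pos)
  ultimately show ?case
    by (simp add: T_def divide_simps) (simp add: algebra_simps)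
next
  case (Suc K)
  \<comment> \<open>Writing \<open>i = Suc K + j\<close> turns the truncated differences
    \<open>i - K\<close>, \<open>i - k\<close> and \<open>Suc i - k\<close> into
    \<open>Suc j\<close>, \<open>j\<close> and \<open>Suc j\<close>, so all four terms of the
    induction step share the factors \<open>Y\<close>, \<open>W\<close> and
    \<open>P\<close>.\<close>
  obtain j where i: "i = Suc K + j" using Suc.prems le_Suc_ex by blast
  define k where "k = Suc K"
  define A where "A = h - real i + y"
  define W where "W = pochhammer A j"
  define V where "V = h - real i - real k - 1"
  define P where "P = pochhammer (V + 1) i"
  define Y where "Y = pochhammer y k"
  define b where "b = real (i choose k)"
  have pos: "V > 0" "P > 0" "h - real k > 0" "real (Suc i) - real k > 0"
    using h i by (auto simp: V_def k_def P_def intro!: pochhammer_pos)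
  have bin1: "real (i choose K) * (real (Suc i) - real k) = real k * b"
  proof -
    have "(i choose K) * (i - K) = Suc K * (i choose Suc K)"
      using Suc_times_binomial_eq[of K "i - 1"] i
      by (metis binomial_absorb_comp binomial_absorption mult.commute)
    then have "real ((i choose K) * (i - K)) = real (Suc K * (i choose Suc K))" by simp
    moreover have "real (i - K) = real (Suc i) - real k" using i by (simp add: k_def)
    ultimately show ?thesis by (simp only: of_nat_mult b_def k_def)
  qed
  have bin2: "real (Suc i choose k) * (real (Suc i) - real k) = real (Suc i) * b"
  proof -
    have "(Suc i choose k) * (Suc i - k) = Suc i * (i choose k)"
      by (metis binomial_absorb_comp diff_Suc_1 mult.commute)
    then have "real ((Suc i choose k) * (Suc i - k)) = real (Suc i * (i choose k))" by simp
    moreover have "real (Suc i - k) = real (Suc i) - real k" using i by (simp add: k_def)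
    ultimately show ?thesis by (simp only: of_nat_mult b_def)
  qed
  have e1: "T (Suc i) k = (-1) ^ k * real (Suc i choose k) * Y * ((A - 1) * W) * (h - 2 * real k) /
      (V * (P * (h - real k)))"
  proof -
    have "Suc i - k = Suc j" using i by (simp add: k_def)
    moreover have "pochhammer (h - real (Suc i) + y) (Suc j) = (A - 1) * W"
      by (simp add: A_def W_def pochhammer_rec algebra_simps)
    moreover have "pochhammer (h - real (Suc i) - real k) (Suc (Suc i)) = V * (P * (h - real k))"
      by (subst pochhammer_rec) (simp add: V_def P_def pochhammer_Suc algebra_simps)
    ultimately show ?thesis by (simp only: T_def Y_def)
  qed
  have e2: "T i k = (-1) ^ k * b * Y * W * (h - 2 * real k) / (P * (h - real k))"
  proof -
    have "i - k = j" using i by (simp add: k_def)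
    moreover have "pochhammer (h - real i - real k) (Suc i) = P * (h - real k)"
      by (simp add: V_def P_def pochhammer_Suc algebra_simps)
    ultimately show ?thesis by (simp only: T_def Y_def b_def W_def A_def)
  qed
  \<comment> \<open>The induction hypothesis in these abbreviations; the minus sign comes from
    \<open>(-1) ^ K = - ((-1) ^ k)\<close>.\<close>
  have e3: "(\<Sum>k\<le>K. T (Suc i) k - T i k) =
     - ((-1) ^ k * real (i choose K) * Y * (W * (A + real j)) / (P * (h - real k)))"
  proof -
    have "i - K = Suc j" using i by simp
    moreover have "pochhammer (h - real i - real K - 1) (Suc i) = P * (h - real k)"
      by (simp add: V_def P_def k_def pochhammer_Suc algebra_simps)
    moreover have "pochhammer A (Suc j) = W * (A + real j)" by (simp add: W_def pochhammer_Suc)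
    ultimately show ?thesis using Suc.IH Suc.prems by (simp add: A_def Y_def k_def)
  qed
  have e4: "(-1) ^ Suc K * real (i choose Suc K) * pochhammer y (Suc (Suc K)) *
      pochhammer (h - real i + y) (i - Suc K) / pochhammer (h - real i - real (Suc K) - 1) (Suc i)
      = (-1) ^ k * b * (Y * (y + real k)) * W / (V * P)"
  proof -
    have "i - k = j" using i by (simp add: k_def)
    moreover have "pochhammer V (Suc i) = V * P" by (simp add: P_def pochhammer_rec)
    moreover have "pochhammer y (Suc k) = Y * (y + real k)" by (simp add: Y_def pochhammer_Suc)
    ultimately show ?thesis by (simp only: b_def W_def A_def V_def flip: k_def)
  qed
  define q where "q = real (Suc i) - real k"
  have q: "q > 0" "real (Suc i choose k) = real (Suc i) * b / q" "real (i choose K) = real k * b / q"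
    using bin1 bin2 pos(4) by (auto simp: q_def field_simps)
  have sub: "A = h - real k + y - real j" "A - 1 = V + real k + y" "V = h - q - 2 * real k"
     "real (Suc i) = q + real k"
    by (auto simp: A_def V_def q_def k_def i)
  \<comment> \<open>What remains of the induction step after division by the common factor
    \<open>X\<close> below: a rational identity. Substituting \<open>h = V + q + 2 * real k\<close>
    makes it polynomial once denominators are cleared.\<close>
  have cert: "- (real k * b / q * (A + real j) / (h - real k)) +
      (real (Suc i) * b / q * (A - 1) * (h - 2 * real k) / (V * (h - real k))
        - b * (h - 2 * real k) / (h - real k)) = b * (y + real k) / V"
  proof -
    have "V \<noteq> 0" "h - real k \<noteq> 0" "q \<noteq> 0" using pos q by auto
    moreover have "A + real j = h - real k + y" using sub by simp
    moreover have h: "h = V + q + 2 * real k" using sub by simp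
    ultimately show ?thesis
      unfolding sub(2,4) by (simp add: divide_simps) (simp add: h algebra_simps)
  qed
  define X where "X = (-1) ^ k * Y * W / P"
  have factor: "(-1) ^ k * real (i choose K) * Y * (W * (A + real j)) / (P * (h - real k)) =
      X * (real k * b / q * (A + real j) / (h - real k))"
    "T (Suc i) k = X * (real (Suc i) * b / q * (A - 1) * (h - 2 * real k) / (V * (h - real k)))"
    "T i k = X * (b * (h - 2 * real k) / (h - real k))"
    "(-1) ^ k * b * (Y * (y + real k)) * W / (V * P) = X * (b * (y + real k) / V)"
    unfolding e1 e2 q(2,3) X_def times_divide_eq_left times_divide_eq_right divide_divide_eq_left
    by (simp_all only: mult_ac)
  then have "- ((-1) ^ k * real (i choose K) * Y * (W * (A + real j)) / (P * (h - real k))) +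
     (T (Suc i) k - T i k) = (-1) ^ k * b * (Y * (y + real k)) * W / (V * P)"
    unfolding factor cert[symmetric] by (simp only: distrib_left right_diff_distrib mult_minus_right)
  then show ?case
    unfolding e4 sum.atMost_Suc e3 by (simp add: k_def)
qed

text \<open>Each summand is the 4F3 term divided by the closed form, so the total should not depend
  on \<open>i\<close>, as the WZ method requires. Passing from \<open>i\<close> to
  \<open>Suc i\<close>, the differences sum by \<open>wz_partial_sum\<close> at \<open>K = i\<close>
  to exactly the negative of the new last term. The bound on \<open>h\<close> keeps the denominators
  positive.\<close>

lemma very_well_poised_sum:
  fixes h y :: real
  assumes "h > 2 * real i"
  shows "(\<Sum>k\<le>i. (-1) ^ k * real (i choose k) * pochhammer y k *
      pochhammer (h - real i + y) (i - k) * (h - 2 * real k) / pochhammer (h - real i - real k) (Suc i)) = 1"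
  using assms
proof (induction i)
  case 0
  then show ?case by simp
next
  case (Suc i)
  define T where "T = (\<lambda>i k. (-1) ^ k * real (i choose k) * pochhammer y k *
      pochhammer (h - real i + y) (i - k) * (h - 2 * real k) / pochhammer (h - real i - real k) (Suc i))"
  have "(\<Sum>k\<le>i. T (Suc i) k - T i k) = (-1) ^ i * pochhammer y (Suc i) /
          pochhammer (h - 2 * real i - 1) (Suc i)"
    using wz_partial_sum[of i h i y] Suc.prems by (simp add: T_def)
  moreover have "T (Suc i) (Suc i) = - ((-1) ^ i * pochhammer y (Suc i) /
          pochhammer (h - 2 * real i - 1) (Suc i))"
  proof -
    have "pochhammer (h - real (Suc i) - real (Suc i)) (Suc (Suc i)) =
       (h - 2 * real (Suc i)) * pochhammer (h - 2 * real i - 1) (Suc i)"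
      by (subst pochhammer_rec) (simp add: algebra_simps)
    then show ?thesis using Suc.prems by (simp add: T_def)
  qed
  moreover have "(\<Sum>k\<le>i. T i k) = 1"
    using Suc by (simp add: T_def)
  ultimately have "(\<Sum>k\<le>Suc i. T (Suc i) k) = 1"
    by (simp add: sum_subtractf)
  then show ?case by (simp add: T_def)
qed

text \<open>\<open>very_well_poised_sum\<close> multiplied by \<open>?c\<close>, with Pochhammer
  symbols rewritten as Gamma quotients: the shape that comparison of coefficients produces. The two
  bounds keep the Gamma arguments positive.\<close>

lemma connection_coeff_sum:
  fixes h y :: real
  assumes h: "h > 2 * real i" and hy: "h + y > real i"
  shows "(\<Sum>k\<le>i. pochhammer y k * Gamma (h + y - real k) / fact k *
       (h - 2 * real k) / Gamma (h - real k + 1) *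
       ((-1) ^ (i - k) * Gamma (h - real k - real i) / fact (i - k))) =
     (-1) ^ i * Gamma (h + y - real i) / fact i" (is "sum ?f _ = ?c")
proof -
  have "?f k = ?c * ((-1) ^ k * real (i choose k) * pochhammer y k *
      pochhammer (h - real i + y) (i - k) * (h - 2 * real k) / pochhammer (h - real i - real k) (Suc i))"
    if k: "k \<le> i" for k
  proof -
    have pos: "h - real i + y > 0" "h - real i - real k > 0" using h hy k by auto
    have "h - real i + y \<notin> \<int>\<^sub>\<le>\<^sub>0" "h - real i - real k \<notin> \<int>\<^sub>\<le>\<^sub>0"
      using pos nonpos_Ints_nonpos by fastforce+
    then have poch: "pochhammer (h - real i + y) (i - k) = Gamma (h + y - real k) / Gamma (h + y - real i)"
      "pochhammer (h - real i - real k) (Suc i) = Gamma (h - real k + 1) / Gamma (h - real k - real i)"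
      using k by (simp_all add: pochhammer_Gamma of_nat_diff algebra_simps)
    moreover have "Gamma (h + y - real i) > 0" "Gamma (h - real k - real i) > 0"
        "Gamma (h - real k + 1) > 0"
      using pos by (auto intro!: Gamma_real_pos)
    moreover have "(-1::real) ^ (i - k) = (-1) ^ i * (-1) ^ k"
      using k by (simp add: minus_one_power_iff)
    ultimately show ?thesis unfolding poch using k by (simp add: binomial_fact mult_ac)
  qed
  then have "sum ?f {..i} = ?c * (\<Sum>k\<le>i. (-1) ^ k * real (i choose k) * pochhammer y k *
      pochhammer (h - real i + y) (i - k) * (h - 2 * real k) / pochhammer (h - real i - real k) (Suc i))"
    unfolding sum_distrib_left by (intro sum.cong) auto
  then show ?thesis by (simp only: very_well_poised_sum[OF h] mult_1_right)
qed

section \<open>Jacobi polynomials expanded at -1\<close>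

text \<open>The coefficient of \<open>((1 + t) / 2) ^ j\<close> in the Jacobi polynomial: its value
  (-1)^k (b+1)_k / k! at t = -1 times the j-th coefficient of 2F1(-k, k+a+b+1; b+1; .).\<close>

definition jacobi_coeff :: "real \<Rightarrow> real \<Rightarrow> nat \<Rightarrow> nat \<Rightarrow> real" where
  "jacobi_coeff a b k j = (-1) ^ k * pochhammer (b + 1) k / fact k *
     (pochhammer (real k + a + b + 1) j * pochhammer (- real k) j / (fact j * pochhammer (b + 1) j))"

text \<open>Up to a power of 2, this is the integral of the expansion against the weight times
  \<open>((1 - t) / 2) ^ i\<close>. The Beta function replaces (b+1)_j by (c)_j in the denominator,
  which leaves a Chu-Vandermonde sum.\<close>

lemma sum_jacobi_coeff_Beta_eq_0:
  assumes a: "a > -1" and b: "b > -1" and i: "i < k"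
  shows "(\<Sum>j\<le>k. jacobi_coeff a b k j * Beta (b + 1 + real j) (a + 1 + real i)) = 0"
proof -
  define c where "c = a + b + 2 + real i"
  have c: "c > 0" using a b by (simp add: c_def)
  have pos: "pochhammer (b + 1) j > 0" for j using b by (intro pochhammer_pos) simp
  have summand: "jacobi_coeff a b k j * Beta (b + 1 + real j) (a + 1 + real i) =
      (-1) ^ k * pochhammer (b + 1) k / fact k * Gamma (a + 1 + real i) * Gamma (b + 1) / Gamma c *
      (pochhammer (real k + a + b + 1) j * pochhammer (- real k) j / (of_nat (fact j) * pochhammer c j))" for j
  proof -
    have "b + 1 \<notin> \<int>\<^sub>\<le>\<^sub>0" "c \<notin> \<int>\<^sub>\<le>\<^sub>0"
      using b c by (auto elim!: nonpos_Ints_cases)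
    then have "Gamma (b + 1 + real j) = Gamma (b + 1) * pochhammer (b + 1) j"
      "Gamma (c + real j) = Gamma c * pochhammer c j"
      by (simp_all add: pochhammer_Gamma Gamma_eq_zero_iff)
    moreover have "b + 1 + real j + (a + 1 + real i) = c + real j" by (simp add: c_def)
    ultimately show ?thesis
      using pos[of j] by (simp only: Beta_def jacobi_coeff_def) (simp add: mult_ac)
  qed
  have "(\<Sum>j\<le>k. pochhammer (real k + a + b + 1) j * pochhammer (- real k) j /
           (of_nat (fact j) * pochhammer c j)) = pochhammer (c - (real k + a + b + 1)) k / pochhammer c k"
    unfolding atMost_atLeast0 by (rule Vandermonde_pochhammer) (use c in auto)
  \<comment> \<open>The base is the integer \<open>i + 1 - k\<close>, between \<open>1 - k\<close>
    and 0, so one of the \<open>k\<close> factors vanishes.\<close>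
  also have "pochhammer (c - (real k + a + b + 1)) k = 0"
  proof -
    have "c - (real k + a + b + 1) = - real (k - 1 - i)"
      using i by (simp add: c_def of_nat_diff)
    then show ?thesis using i by (simp only: pochhammer_of_nat_eq_0_iff)
  qed
  finally show ?thesis
    by (simp only: summand sum_distrib_left[symmetric] div_0 mult_zero_right)
qed

text \<open>Normalization at t = 1. Chu-Vandermonde with lower parameter \<open>b + 1\<close> gives
  (-k-a)_k = (-1)^k (a+1)_k, whose sign cancels the one in \<open>jacobi_coeff\<close>.\<close>

lemma sum_jacobi_coeff:
  assumes "b > -1"
  shows "(\<Sum>j\<le>k. jacobi_coeff a b k j) = (real k + a) gchoose k"
proof -
  have pos: "pochhammer (b + 1) k > 0" using assms by (intro pochhammer_pos) simp
  have "(\<Sum>j\<le>k. jacobi_coeff a b k j) = (-1) ^ k * pochhammer (b + 1) k / fact k *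
      (\<Sum>j\<le>k. pochhammer (real k + a + b + 1) j * pochhammer (- real k) j /
           (of_nat (fact j) * pochhammer (b + 1) j))"
    by (simp only: jacobi_coeff_def sum_distrib_left of_nat_fact)
  also have "(\<Sum>j\<le>k. pochhammer (real k + a + b + 1) j * pochhammer (- real k) j /
           (of_nat (fact j) * pochhammer (b + 1) j)) =
        pochhammer (b + 1 - (real k + a + b + 1)) k / pochhammer (b + 1) k"
    unfolding atMost_atLeast0 by (rule Vandermonde_pochhammer) (use assms in auto)
  also have "pochhammer (b + 1 - (real k + a + b + 1)) k = (-1) ^ k * pochhammer (a + 1) k"
    using pochhammer_minus[of "real k + a" k] by (simp add: algebra_simps)
  finally show ?thesis
    using pos by (simp add: gbinomial_pochhammer')
qed

lemma jacobi_coeff_leading_nonzero: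
  assumes "a > -1" "b > -1"
  shows "jacobi_coeff a b k k \<noteq> 0"
proof -
  \<comment> \<open>For \<open>k = 0\<close> the base \<open>a + b + 1\<close> may be negative, but
    the product is empty; for \<open>k > 0\<close> the base is positive.\<close>
  have "pochhammer (real k + a + b + 1) k \<noteq> 0"
    using assms by (cases "k = 0") (auto intro!: pochhammer_pos less_imp_neq[symmetric])
  moreover have "pochhammer (b + 1) k > 0"
    using assms by (intro pochhammer_pos) simp
  ultimately show ?thesis
    by (simp add: jacobi_coeff_def pochhammer_of_nat_eq_0_iff)
qed

text \<open>The expansion has degree \<open>k\<close>, the right value at 1 and the orthogonality
  property, so it is the Jacobi polynomial by uniqueness. Orthogonality is tested on powers of
  \<open>(1 - t) / 2\<close>: against powers of \<open>(1 + t) / 2\<close> these give Beta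
  integrals.\<close>

lemma poly_jacobi_poly:
  assumes a: "a > -1" and b: "b > -1"
  shows "poly (jacobi_poly a b k) (2 * s - 1) = (\<Sum>j\<le>k. jacobi_coeff a b k j * s ^ j)"
proof -
  define p where "p = pcompose (\<Sum>j\<le>k. monom (jacobi_coeff a b k j) j) [:1/2, 1/2:]"
  have poly_p: "poly p t = (\<Sum>j\<le>k. jacobi_coeff a b k j * ((1 + t) / 2) ^ j)" for t
    by (simp add: p_def poly_pcompose poly_sum poly_monom add_divide_distrib)
  have "degree (\<Sum>j\<le>k. monom (jacobi_coeff a b k j) j) = k"
  proof (rule antisym)
    show "degree (\<Sum>j\<le>k. monom (jacobi_coeff a b k j) j) \<le> k"
      by (intro degree_sum_le) (auto intro: order.trans[OF degree_monom_le])
    have "coeff (\<Sum>j\<le>k. monom (jacobi_coeff a b k j) j) k = jacobi_coeff a b k k"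
      by (simp add: coeff_sum)
    then show "k \<le> degree (\<Sum>j\<le>k. monom (jacobi_coeff a b k j) j)"
      using jacobi_coeff_leading_nonzero[OF a b] by (simp add: le_degree)
  qed
  then have deg: "degree p = k" by (simp add: p_def degree_pcompose)
  let ?w = "\<lambda>t::real. (1 - t) powr a * (1 + t) powr b"
  have orth1: "((\<lambda>t. ?w t * (poly p t * ((1 - t) / 2) ^ i)) has_integral 0) {-1<..<1}"
    if "i < k" for i
  proof -
    have "((\<lambda>t. \<Sum>j\<le>k. jacobi_coeff a b k j * (?w t * (((1 - t) / 2) ^ i * ((1 + t) / 2) ^ j)))
       has_integral (\<Sum>j\<le>k. jacobi_coeff a b k j *
         (2 powr (a + b + 1) * Beta (b + 1 + real j) (a + 1 + real i)))) {-1<..<1}"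
      by (intro has_integral_sum has_integral_mult_right has_integral_jacobi_moment a b) auto
    moreover have "(\<Sum>j\<le>k. jacobi_coeff a b k j *
         (2 powr (a + b + 1) * Beta (b + 1 + real j) (a + 1 + real i))) = 0"
      using sum_jacobi_coeff_Beta_eq_0[OF a b that]
      by (simp only: mult.left_commute[of _ "2 powr _"] sum_distrib_left[symmetric] mult_zero_right)
    ultimately show ?thesis
      by (simp add: poly_p sum_distrib_left sum_distrib_right mult_ac)
  qed
  have orth: "((\<lambda>t. ?w t * (poly p t * poly q t)) has_integral 0) {-1<..<1}"
    if q: "degree q < k" for q
  proof -
    \<comment> \<open>\<open>q\<close> in the variable u = (1 - t)/2, that is, t = 1 - 2u.\<close>
    define r where "r = pcompose q [:1, -2:]"
    have "poly q t = poly r ((1 - t) / 2)" for t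
      by (simp add: r_def poly_pcompose diff_divide_distrib)
    moreover have "degree r = degree q" by (simp add: r_def degree_pcompose)
    ultimately have pq: "poly q t = (\<Sum>i\<le>degree q. coeff r i * ((1 - t) / 2) ^ i)" for t
      by (simp add: poly_altdef)
    have "((\<lambda>t. \<Sum>i\<le>degree q. coeff r i * (?w t * (poly p t * ((1 - t) / 2) ^ i)))
       has_integral (\<Sum>i\<le>degree q. coeff r i * 0)) {-1<..<1}"
      by (intro has_integral_sum has_integral_mult_right orth1) (use q in auto)
    then show ?thesis
      by (simp add: pq sum_distrib_left mult_ac)
  qed
  have "poly p 1 = (real k + a) gchoose k"
    using sum_jacobi_coeff[OF b] by (simp add: poly_p)
  with deg orth have "is_jacobi_poly a b k p"
    by (simp add: is_jacobi_poly_def)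
  then have "jacobi_poly a b k = p"
    using is_jacobi_poly_unique is_jacobi_poly_jacobi_poly a b by blast
  then show ?thesis by (simp add: poly_p)
qed

section \<open>Zernike polynomials in powers of the squared radius\<close>

text \<open>The radial polynomial in s = r^2 for l = min(m,n) and d = |m-n|, without the factor r^d
  and the constants. The index counts down from the leading power, so that lowering \<open>l\<close>
  by \<open>k\<close> becomes a shift of \<open>i\<close> by \<open>k\<close>.\<close>

definition zernike_sum :: "real \<Rightarrow> nat \<Rightarrow> nat \<Rightarrow> real \<Rightarrow> real" where
  "zernike_sum a d l s = (\<Sum>i\<le>l. (-1) ^ i * Gamma (a + 2 * real l + real d - real i + 1) /
     (fact i * fact (l - i) * fact (l + d - i)) * s ^ (l - i))"

text \<open>For an integer second parameter, (d+1)_j = (d+j)!/d!, so the coefficients become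
  factorials and one Gamma quotient; \<open>j = l - i\<close> reverses the order of
  summation.\<close>

lemma poly_jacobi_poly_of_nat:
  assumes a: "a > -1"
  shows "poly (jacobi_poly a (real d) l) (2 * s - 1) =
    fact (l + d) / Gamma (a + real l + real d + 1) * zernike_sum a d l s"
proof -
  have "jacobi_coeff a (real d) l (l - i) = fact (l + d) / Gamma (a + real l + real d + 1) *
     ((-1) ^ i * Gamma (a + 2 * real l + real d - real i + 1) /
     (fact i * fact (l - i) * fact (l + d - i)))" if i: "i \<le> l" for i
  proof -
    obtain j where l: "l = i + j" using i le_Suc_ex by blast
    have fact_poch: "pochhammer (real d + 1) n = fact (d + n) / fact d" for n
      using pochhammer_product[of d "d + n" "1::real"]
      by (simp add: field_simps flip: pochhammer_fact)
    have "pochhammer (- real l) j = (-1) ^ j * pochhammer (1 + real i) j"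
      by (simp only: pochhammer_minus) (simp add: l add.commute)
    then have poch_l: "pochhammer (- real l) j = (-1) ^ j * fact l / fact i"
      using pochhammer_product[of i l "1::real"]
      by (simp add: l field_simps flip: pochhammer_fact)
    have poch_a: "pochhammer (real l + a + real d + 1) j =
        Gamma (a + 2 * real l + real d - real i + 1) / Gamma (a + real l + real d + 1)"
    proof -
      have "real l + a + real d + 1 \<notin> \<int>\<^sub>\<le>\<^sub>0"
        using a by (auto elim!: nonpos_Ints_cases)
      then show ?thesis by (simp add: pochhammer_Gamma l algebra_simps)
    qed
    have sign: "(-1::real) ^ l * (-1) ^ j = (-1) ^ i"
      by (simp add: l power_add flip: power_mult_distrib)
    have "l - i = j" "l + d - i = d + j" using l by auto
    then show ?thesis
      unfolding jacobi_coeff_def fact_poch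
      by (simp only: poch_a poch_l fact_poch sign[symmetric]) (simp add: mult_ac add.commute)
  qed
  moreover have "(\<Sum>j\<le>l. jacobi_coeff a (real d) l j * s ^ j) =
      (\<Sum>i\<le>l. jacobi_coeff a (real d) l (l - i) * s ^ (l - i))"
    by (rule sum.reindex_bij_witness[of _ "\<lambda>i. l - i" "\<lambda>i. l - i"]) auto
  ultimately show ?thesis
    using a by (simp add: poly_jacobi_poly) (simp add: zernike_sum_def sum_distrib_left sum_divide_distrib mult_ac)
qed

text \<open>The j-th term of the k-th polynomial on the right has the power s^(l-k-j). Collecting by
  i = k + j leaves \<open>connection_coeff_sum\<close> as the coefficient identity.\<close>

lemma zernike_sum_connection:
  fixes \<alpha> \<gamma> :: real and d :: nat
  assumes "\<alpha> > -1" "\<gamma> > -1"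
  defines "N \<equiv> \<lambda>l. 2 * real l + real d"
  shows "zernike_sum \<alpha> d l s =
    (\<Sum>k\<le>l. pochhammer (\<alpha> - \<gamma>) k * Gamma (\<alpha> + N l - real k + 1) / fact k *
      (\<gamma> + N l - 2 * real k + 1) / Gamma (\<gamma> + N l - real k + 2) * zernike_sum \<gamma> d (l - k) s)"
proof -
  define h where "h = \<gamma> + N l + 1"
  define y where "y = \<alpha> - \<gamma>"
  define A where "A = (\<lambda>k. pochhammer y k * Gamma (h + y - real k) / fact k *
      (h - 2 * real k) / Gamma (h - real k + 1))"
  define B where "B = (\<lambda>k j. (-1) ^ j * Gamma (h - 2 * real k - real j) / fact j)"
  \<comment> \<open>\<open>E\<close> takes the factors that depend on \<open>k\<close> and
    \<open>j\<close> only through \<open>k + j\<close>; it can be pulled out of the sum over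
    \<open>k\<close> at fixed \<open>i = k + j\<close>.\<close>
  define E where "E = (\<lambda>i. s ^ (l - i) / (fact (l - i) * fact (l + d - i)))"
  have "(\<Sum>k\<le>l. A k * zernike_sum \<gamma> d (l - k) s) = (\<Sum>k\<le>l. \<Sum>j\<le>l - k. A k * B k j * E (k + j))"
  proof (rule sum.cong[OF refl])
    fix k assume k: "k \<in> {..l}"
    have "A k * zernike_sum \<gamma> d (l - k) s = (\<Sum>j\<le>l - k. A k * ((-1) ^ j *
        Gamma (\<gamma> + 2 * real (l - k) + real d - real j + 1) /
       (fact j * fact (l - k - j) * fact (l - k + d - j)) * s ^ (l - k - j)))"
      by (simp add: zernike_sum_def sum_distrib_left)
    also have "\<dots> = (\<Sum>j\<le>l - k. A k * B k j * E (k + j))"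
    proof (rule sum.cong[OF refl])
      fix j assume "j \<in> {..l - k}"
      then have "l - k + d - j = l + d - (k + j)" "l - k - j = l - (k + j)" using k by auto
      moreover have "\<gamma> + 2 * real (l - k) + real d - real j + 1 = h - 2 * real k - real j"
        using k by (simp add: h_def N_def of_nat_diff)
      ultimately show "A k * ((-1) ^ j * Gamma (\<gamma> + 2 * real (l - k) + real d - real j + 1) /
         (fact j * fact (l - k - j) * fact (l - k + d - j)) * s ^ (l - k - j)) = A k * B k j * E (k + j)"
        by (simp only: B_def E_def) simp
    qed
    finally show "A k * zernike_sum \<gamma> d (l - k) s = (\<Sum>j\<le>l - k. A k * B k j * E (k + j))" .
  qed
  also have "\<dots> = (\<Sum>(k, j)\<in>{(k, j). k + j \<le> l}. A k * B k j * E (k + j))"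
    by (subst sum.Sigma) (auto intro!: sum.cong)
  also have "\<dots> = (\<Sum>i\<le>l. \<Sum>k\<le>i. A k * B k (i - k) * E (k + (i - k)))"
    by (rule sum.triangle_reindex_eq)
  also have "\<dots> = (\<Sum>i\<le>l. (-1) ^ i * Gamma (h + y - real i) / fact i * E i)"
  proof (rule sum.cong[OF refl])
    fix i assume i: "i \<in> {..l}"
    have "(\<Sum>k\<le>i. A k * B k (i - k) * E (k + (i - k))) = (\<Sum>k\<le>i. A k * B k (i - k)) * E i"
      by (simp add: sum_distrib_right)
    also have "(\<Sum>k\<le>i. A k * B k (i - k)) = (\<Sum>k\<le>i. pochhammer y k * Gamma (h + y - real k) / fact k *
       (h - 2 * real k) / Gamma (h - real k + 1) *
       ((-1) ^ (i - k) * Gamma (h - real k - real i) / fact (i - k)))"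
      by (intro sum.cong refl) (simp add: A_def B_def of_nat_diff algebra_simps)
    also have "\<dots> = (-1) ^ i * Gamma (h + y - real i) / fact i"
      \<comment> \<open>Since \<open>i \<le> l\<close>, \<open>h - 2 * real i\<close> is at least
        \<gamma> + 1 > 0; also \<open>h + y\<close> = \<alpha> + 2l + d + 1 exceeds
        \<open>i\<close>.\<close>
      by (rule connection_coeff_sum) (use assms i in \<open>auto simp: h_def y_def N_def\<close>)
    finally show "(\<Sum>k\<le>i. A k * B k (i - k) * E (k + (i - k))) =
      (-1) ^ i * Gamma (h + y - real i) / fact i * E i" .
  qed
  also have "\<dots> = zernike_sum \<alpha> d l s"
    by (simp add: zernike_sum_def E_def h_def y_def N_def algebra_simps)
  finally show ?thesis
    by (simp add: A_def h_def y_def algebra_simps)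
qed

text \<open>The factors at \<open>l\<close> come from the Zernike prefactor, those at
  \<open>l + d\<close> from \<open>poly_jacobi_poly_of_nat\<close>. As {l, l+d} = {m, n}, together
  they are symmetric in \<open>m\<close> and \<open>n\<close>.\<close>

lemma zernike_eq_zernike_sum:
  fixes m n :: nat
  assumes a: "a > -1"
  defines "d \<equiv> nat \<bar>int m - int n\<bar>"
  shows "zernike a m n z =
    of_real (cmod z ^ d) * exp (\<i> * of_int (int m - int n) * of_real (Arg z)) *
    of_real (fact m * fact n * Gamma (a + 1) / (Gamma (a + real m + 1) * Gamma (a + real n + 1)) *
       zernike_sum a d (min m n) ((cmod z)\<^sup>2))"
proof -
  define l where "l = min m n"
  have mn: "(m = l \<and> n = l + d) \<or> (n = l \<and> m = l + d)"
    by (auto simp: l_def d_def)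
  have eq: "Gamma (real l + 1) * Gamma (a + 1) / Gamma (real l + a + 1) *
      poly (jacobi_poly a (real d) l) (2 * (cmod z)\<^sup>2 - 1) =
    fact m * fact n * Gamma (a + 1) / (Gamma (a + real m + 1) * Gamma (a + real n + 1)) *
       zernike_sum a d l ((cmod z)\<^sup>2)"
    using mn poly_jacobi_poly_of_nat[OF a, of d l "(cmod z)\<^sup>2"]
    by (auto simp: Gamma_fact algebra_simps)
  show ?thesis
    unfolding zernike_def Let_def l_def[symmetric] d_def[symmetric] eq[symmetric] of_real_mult
    by (simp only: mult_ac)
qed

section \<open>The connection formula with its constants\<close>

theorem proposition3p1:
  fixes \<alpha> \<gamma> :: real and m n :: nat
  assumes "\<alpha> > -1" and "\<gamma> > -1"
  shows "\<forall>z \<in> ball (0::complex) 1.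
    zernike \<alpha> m n z =
      of_real (Gamma (real m + 1) * Gamma (real n + 1) * Gamma (\<alpha> + 1) /
        (Gamma (\<alpha> + real m + 1) * Gamma (\<alpha> + real n + 1) * Gamma (\<gamma> + 1))) *
      (\<Sum>k = 0..min m n.
        of_real
          (pochhammer (\<alpha> - \<gamma>) k * Gamma (\<alpha> + real m + real n - real k + 1) /
             Gamma (real k + 1) *
           (Gamma (\<gamma> + real m - real k + 1) * Gamma (\<gamma> + real n - real k + 1) *
              (\<gamma> + real m + real n - 2 * real k + 1) /
            (Gamma (real m - real k + 1) * Gamma (real n - real k + 1) *
              Gamma (\<gamma> + real m + real n - real k + 2)))) *
        zernike \<gamma> (m - k) (n - k) z)"
    (is "\<forall>z\<in>_. _ = of_real ?C * (\<Sum>k = 0..min m n. of_real (?c k) * _ k z)")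
proof
  fix z :: complex
  define d where "d = nat \<bar>int m - int n\<bar>"
  define l where "l = min m n"
  define s where "s = (cmod z)\<^sup>2"
  \<comment> \<open>The radial power and angular factor depend only on m - n, hence are common to
    all (m-k, n-k) with k \<le> min(m,n).\<close>
  define e where "e = of_real (cmod z ^ d) * exp (\<i> * of_int (int m - int n) * of_real (Arg z))"
  define D where "D = (\<lambda>a m n. fact m * fact n * Gamma (a + 1) /
      (Gamma (a + real m + 1) * Gamma (a + real n + 1)))"
  have N: "2 * real l + real d = real m + real n"
    by (auto simp: l_def d_def min_def)
  have zern: "zernike a (m - k) (n - k) z = e * of_real (D a (m - k) (n - k) * zernike_sum a d (l - k) s)"
    if "a > -1" "k \<le> l" for a k
  proof -
    have "int (m - k) - int (n - k) = int m - int n" "min (m - k) (n - k) = l - k"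
      using that by (auto simp: l_def)
    then show ?thesis
      using zernike_eq_zernike_sum[OF that(1), of "m - k" "n - k" z]
      by (simp only: e_def d_def D_def s_def)
  qed
  \<comment> \<open>The numerator Gamma factors of \<open>?c k\<close> at \<gamma>+m-k+1 and
    \<gamma>+n-k+1 cancel the denominator of \<open>D \<gamma> (m - k) (n - k)\<close>, those at
    m-k+1 and n-k+1 cancel its factorials, and \<open>Gamma (\<gamma> + 1)\<close> cancels against
    \<open>?C\<close>.\<close>
  have coeff: "D \<alpha> m n * (pochhammer (\<alpha> - \<gamma>) k * Gamma (\<alpha> + (real m + real n) - real k + 1) / fact k *
      (\<gamma> + (real m + real n) - 2 * real k + 1) / Gamma (\<gamma> + (real m + real n) - real k + 2)) =
      ?C * (?c k * D \<gamma> (m - k) (n - k))" if k: "k \<le> l" for k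
  proof -
    have kmn: "k \<le> m" "k \<le> n" using k by (auto simp: l_def)
    have pos: "Gamma (\<gamma> + real m - real k + 1) > 0" "Gamma (\<gamma> + real n - real k + 1) > 0"
      "Gamma (\<gamma> + 1) > 0"
      using kmn assms by (auto intro!: Gamma_real_pos)
    have "Gamma (real m + 1) = fact m" "Gamma (real n + 1) = fact n" "Gamma (real k + 1) = fact k"
      "Gamma (real m - real k + 1) = fact (m - k)" "Gamma (real n - real k + 1) = fact (n - k)"
      using kmn Gamma_fact[of _, where 'a = real] by (simp_all add: add.commute flip: of_nat_diff)
    moreover have "\<gamma> + real (m - k) + 1 = \<gamma> + real m - real k + 1"
      "\<gamma> + real (n - k) + 1 = \<gamma> + real n - real k + 1"
      "\<gamma> + (real m + real n) - real k + 2 = \<gamma> + real m + real n - real k + 2"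
      "\<gamma> + (real m + real n) - 2 * real k + 1 = \<gamma> + real m + real n - 2 * real k + 1"
      "\<alpha> + (real m + real n) - real k + 1 = \<alpha> + real m + real n - real k + 1"
      using kmn by (simp_all add: of_nat_diff)
    ultimately show ?thesis
      using pos by (simp only: D_def) simp
  qed
  have "zernike \<alpha> m n z = e * of_real (D \<alpha> m n * zernike_sum \<alpha> d l s)"
    using zern[of \<alpha> 0] assms by simp
  also have "D \<alpha> m n * zernike_sum \<alpha> d l s =
      ?C * (\<Sum>k\<le>l. ?c k * (D \<gamma> (m - k) (n - k) * zernike_sum \<gamma> d (l - k) s))"
    unfolding zernike_sum_connection[OF assms, of d l s] N sum_distrib_left
  proof (rule sum.cong[OF refl], goal_cases)
    case (1 k)
    then show ?case using coeff[of k] by (simp only: atMost_iff mult.assoc[symmetric])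
  qed
  also have "e * of_real \<dots> = of_real ?C * (\<Sum>k\<le>l. of_real (?c k) *
      (e * of_real (D \<gamma> (m - k) (n - k) * zernike_sum \<gamma> d (l - k) s)))"
    by (simp only: of_real_mult of_real_sum sum_distrib_left mult_ac)
  also have "(\<Sum>k\<le>l. of_real (?c k) *
      (e * of_real (D \<gamma> (m - k) (n - k) * zernike_sum \<gamma> d (l - k) s))) =
      (\<Sum>k = 0..l. of_real (?c k) * zernike \<gamma> (m - k) (n - k) z)"
    using assms by (intro sum.cong) (auto simp only: atMost_atLeast0 zern atLeastAtMost_iff)
  finally show "zernike \<alpha> m n z = of_real ?C *
      (\<Sum>k = 0..min m n. of_real (?c k) * zernike \<gamma> (m - k) (n - k) z)"
    unfolding l_def .
qed

end
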